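(* Let $\mathfrak A$ be a finite-dimensional unital associative algebra over $\mathbb C$ and let $F$ be a multiplicative functional on $\mathfrak A$. Then $A_F$ has rank $1$.
   Context: $A_F$ is the bilinear form $A_F(x,y)=F(xy)$ on $\mathfrak A$, i.e. the matrix $(F(e_ie_j))_{i,j}$ in a basis $\{e_i\}$ of $\mathfrak A$. A multiplicative functional is a linear functional $F:\mathfrak A\to\mathbb C$ with $F(ab)=F(a)F(b)$ for all $a,b\in\mathfrak A$ and $F(1)=1$. *)

theory Defs
  imports Complex_Main "Jordan_Normal_Form.DL_Rank"
begin

text \<open>The sort \<open>{ring, monoid_mult}\<close> is that of unital associative rings in which \<open>0 = 1\<close>
  is not excluded, in contrast to \<open>ring_1\<close>.\<close>

locale fin_dim_complex_algebra = Vector_Spaces.vector_space scale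
  for scale :: "complex \<Rightarrow> 'a :: {ring, monoid_mult} \<Rightarrow> 'a" (infixr \<open>*s\<close> 75) +
  assumes scale_mult_left: "(c *s x) * y = c *s (x * y)"
    and scale_mult_right: "x * (c *s y) = c *s (x * y)"
    and finite_dimensional: "\<exists>B. finite B \<and> span B = UNIV"
begin

definition multiplicative_functional :: "('a \<Rightarrow> complex) \<Rightarrow> bool" where
  "multiplicative_functional F \<longleftrightarrow>
     Vector_Spaces.linear scale (*) F \<and> (\<forall>a b. F (a * b) = F a * F b) \<and> F 1 = 1"

definition ordered_basis :: "'a list \<Rightarrow> bool" where
  "ordered_basis es \<longleftrightarrow> distinct es \<and> independent (set es) \<and> span (set es) = UNIV"

lemma ex_ordered_basis: "\<exists>es. ordered_basis es"
proof -
  obtain B where B: "finite B" "span B = UNIV"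
    using finite_dimensional by blast
  obtain C where C: "C \<subseteq> B" "independent C" "span C = span B"
    using maximal_independent_subset[of B] span_mono[of _ B] span_minimal[of B]
    by (metis span_eq span_superset subset_trans)
  then obtain es where "set es = C" "distinct es"
    using B finite_distinct_list finite_subset by metis
  with B C show ?thesis
    unfolding ordered_basis_def by auto
qed

end

definition functional_form :: "('a :: times \<Rightarrow> complex) \<Rightarrow> 'a \<Rightarrow> 'a \<Rightarrow> complex" where
  "functional_form F x y = F (x * y)"

definition form_matrix :: "('a \<Rightarrow> 'a \<Rightarrow> complex) \<Rightarrow> 'a list \<Rightarrow> complex mat" where
  "form_matrix A es = mat (length es) (length es) (\<lambda>(i, j). A (es ! i) (es ! j))"


end

theory Submission
  imports Defs
begin

text \<open>If \<open>F\<close> is multiplicative, then \<open>F (e\<^sub>i * e\<^sub>j) = F e\<^sub>i * F e\<^sub>j\<close>, so the matrix of the form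
  is the outer product \<open>v v\<^sup>T\<close> of the vector \<open>v\<close> of values of \<open>F\<close> on the basis.  An outer product
  has rank at most \<open>1\<close>, because each column is a multiple of one vector, and rank exactly \<open>1\<close>
  as soon as one entry is nonzero (\<open>rank_eq_1_product_entries\<close>).  The vector \<open>v\<close> is nonzero because
  \<open>F\<close> is linear and \<open>F 1 = 1\<close>: a linear functional that vanishes on a spanning set vanishes
  everywhere (\<open>nonzero_on_basis\<close>).  A diagonal entry \<open>(F e\<^sub>i)\<^sup>2\<close> is then nonzero.\<close>

lemma (in vec_space) lin_indpt_singleton:
  assumes "v \<in> carrier_vec n" and "v \<noteq> 0\<^sub>v n"
  shows "lin_indpt {v}"
proof -
  have "lin_indpt {}"
    by (simp add: lin_dep_def)
  moreover have "v \<notin> span {}"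
    using assms(2) span_empty by simp
  ultimately show ?thesis
    using lin_dep_iff_in_span[of "{}" v] assms(1) by simp
qed

text \<open>The column through a nonzero entry is by itself a linearly independent set of columns.\<close>

lemma (in vec_space) rank_ge_1_nonzero_entry:
  assumes A: "A \<in> carrier_mat n nc"
    and ij: "i < n" "j < nc" "A $$ (i, j) \<noteq> 0"
  shows "1 \<le> rank A"
proof -
  have "col A j \<in> carrier_vec n"
    using A by auto
  moreover have "col A j \<noteq> 0\<^sub>v n"
  proof
    assume "col A j = 0\<^sub>v n"
    then have "col A j $ i = 0"
      using ij by simp
    with A ij show False
      by simp
  qed
  ultimately have "lin_indpt {col A j}"
    by (rule lin_indpt_singleton)
  moreover have "{col A j} \<subseteq> set (cols A)"
    using A ij by (auto simp: cols_def)
  ultimately show ?thesis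
    using rank_ge_card_indpt[OF A, of "{col A j}"] by simp
qed

lemma (in vec_space) rank_eq_1_product_entries:
  fixes f g :: "nat \<Rightarrow> 'a"
  assumes A: "A \<in> carrier_mat n nc"
    and entries: "\<And>r c. r < n \<Longrightarrow> c < nc \<Longrightarrow> A $$ (r, c) = f r * g c"
    and ij: "i < n" "j < nc" "f i \<noteq> 0" "g j \<noteq> 0"
  shows "rank A = 1"
proof (rule antisym)
  show "rank A \<le> 1"
    using A entries by (intro rank_le_1_product_entries) auto
  show "1 \<le> rank A"
    using ij by (intro rank_ge_1_nonzero_entry[OF A ij(1,2)]) (simp add: entries)
qed

text \<open>The normalisation \<open>F 1 = 1\<close> excludes the zero functional, and with it the zero algebra,
  whose only basis is empty: otherwise \<open>1\<close> would lie in the span of vectors killed by \<open>F\<close>.\<close>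

lemma (in fin_dim_complex_algebra) nonzero_on_basis:
  assumes "multiplicative_functional F" and "ordered_basis es"
  obtains i where "i < length es" and "F (es ! i) \<noteq> 0"
proof -
  interpret F: Vector_Spaces.linear scale "(*)" F
    using assms(1) by (simp add: multiplicative_functional_def)
  have "\<exists>e\<in>set es. F e \<noteq> 0"
  proof (rule ccontr)
    assume "\<not> ?thesis"
    then have "F 1 = 0"
      using assms(2) by (intro F.eq_0_on_span[of "set es" 1]) (auto simp: ordered_basis_def)
    then show False
      using assms(1) by (simp add: multiplicative_functional_def)
  qed
  then show thesis
    using that by (auto simp: in_set_conv_nth)
qed

theorem proposition8:
  fixes scale :: "complex \<Rightarrow> 'a :: {ring, monoid_mult} \<Rightarrow> 'a"
    and F :: "'a \<Rightarrow> complex"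
    and es :: "'a list"
  assumes "fin_dim_complex_algebra scale"
    and "fin_dim_complex_algebra.multiplicative_functional scale F"
    and "fin_dim_complex_algebra.ordered_basis scale es"
  shows "vec_space.rank (length es) (form_matrix (functional_form F) es) = 1"
proof -
  interpret fin_dim_complex_algebra scale
    by (fact assms(1))
  obtain i where i: "i < length es" "F (es ! i) \<noteq> 0"
    using nonzero_on_basis[OF assms(2,3)] .
  have F_mult: "F (a * b) = F a * F b" for a b
    using assms(2) by (simp add: multiplicative_functional_def)
  let ?v = "\<lambda>k. F (es ! k)"
  show ?thesis
    by (rule vec_space.rank_eq_1_product_entries[where f = ?v and g = ?v and i = i and j = i])
      (auto simp: form_matrix_def functional_form_def F_mult i)
qed

end
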